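(* Let $n\ge0$ be an integer and let $y=(y_0,\dots,y_n)\in[0,\infty)^{n+1}$ be the given data. The iterates $x^t$, $t\ge0$, of the deautoconvolution algorithm for $y$, started at a point $x^0\in(0,\infty)^{n+1}$ (defined in the context, together with $r^t$, $\mathbf{Y}^t$, $\mathbf{W}^t$), satisfy the following properties. (i) If $x^0>0$ componentwise, then $x^t>0$ componentwise, for all $t>0$. (ii) The iterates $x^t$ belong to the set $\mathcal{S}=\{x\in[0,\infty)^{n+1}:\sum_{i=0}^n(x*x)_i=\sum_{i=0}^n y_i\}$ for all $t>0$. Additionally, $\sum_{j=0}^n x^t_j\nabla_j\mathcal{I}(x^t)=0$ for $t\ge1$. (iii) $\mathcal{I}(y\|x^t*x^t)$ decreases at each iteration; in fact one has $$\mathcal{I}(y\|x^t*x^t)-\mathcal{I}(y\|x^{t+1}*x^{t+1})=\mathcal{I}(\mathbf{Y}^t\|\mathbf{Y}^{t+1})+\mathcal{I}(\mathbf{W}^{t+1}\|\mathbf{W}^t)\ge0,$$ where one can use the expression $$\mathcal{I}(\mathbf{W}^{t+1}\|\mathbf{W}^t)=2\sum_{j=0}^n r^t_j\log\frac{x^{t+1}_j}{x^t_j}.$$ As a corollary, $\mathcal{I}(\mathbf{W}^{t+1}\|\mathbf{W}^t)$ vanishes asymptotically, i.e. tends to $0$ as $t\to\infty$. (iv) If $y=x^t*x^t$ then $x^{t+1}=x^t$, i.e. perfect matches are fixed points of the algorithm. (v) The update relation can be written in an (implicit) formula in terms of the gradient: $$x^{t+1}_j\sum_{i=0}^{n-j}x^{t+1}_i=x^t_j\Big(-\tfrac12\nabla_j\mathcal{I}(x^t)+\sum_{i=0}^{n-j}x^t_i\Big),\qquad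 j=0,\dots,n.$$ (vi) If $\nabla\mathcal{I}(x^t)=0$ then $x^{t+1}=x^t$, i.e. stationary points of $\mathcal{I}(x)$ are fixed points of the algorithm. Additionally, if $x^t_j=0$, then also $x^{t+1}_j=0$.
   Context: For $x=(x_0,\dots,x_n)\in[0,\infty)^{n+1}$ let $(x*x)_i=\sum_{j=0}^i x_{i-j}x_j$, $i=0,\dots,n$, and view $x*x$ as a vector in $\mathbb{R}^{n+1}$. The $\mathcal{I}$-divergence of nonnegative arrays (vectors or matrices) $u,v$ of equal size is $\mathcal{I}(u\|v)=\sum\big(u\log\frac{u}{v}-u+v\big)$, summed over all entries, if $u$ vanishes wherever $v$ does, and $+\infty$ otherwise. Given data $y$, put $\mathcal{I}(x)=\mathcal{I}(y\|x*x)$. The gradient $\nabla\mathcal{I}(x)$ has components $$\nabla_k\mathcal{I}(x)=\frac{\partial\mathcal{I}(x)}{\partial x_k}=-2\sum_{j=0}^{n-k}\Big(\frac{y_{j+k}}{(x*x)_{j+k}}-1\Big)x_j,\qquad k=0,\dots,n.$$ Deautoconvolution algorithm: start at a point $x^0\in(0,\infty)^{n+1}$. Given the $t$-th iterate $x^t$, set $\rho^t_i=y_i/(x^t*x^t)_i$ and $$r^t_j=x^t_j\sum_{i=0}^{n-j}x^t_i\,\rho^t_{i+j},\qquad j=0,\dots,n,$$ and let $x^{t+1}\in[0,\infty)^{n+1}$ be the solution of the system $$x^{t+1}_j\sum_{i=0}^{n-j}x^{t+1}_i=r^t_j,\qquad j=0,\dots,n.$$ The $(n+1)\times(n+1)$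 matrices $\mathbf{W}^t$ and $\mathbf{Y}^t$ (indices from $0$ to $n$) are given by $\mathbf{W}^t_{ij}=x^t_{i-j}x^t_j$ and $\mathbf{Y}^t_{ij}=x^t_jx^t_{i-j}\rho^t_i$ for $j\le i$, and $\mathbf{W}^t_{ij}=\mathbf{Y}^t_{ij}=0$ for $i<j$.
   Formalization: Assumes y is not zero unless n=0 (for y=0, n≥1 the system has many solutions); (i) is stated for y_n>0 (it fails if y_n=0); the log expression for I(W^{t+1}||W^t) is stated for x^t in S, so for all t≥1 (it can fail at t=0). *)

theory Defs
  imports "HOL-Analysis.Analysis"
begin

(* A vector (v_0, ..., v_n) is a function nat => real of which only the values at
   indices <= n matter; an (n+1) x (n+1) matrix is a function on pairs of such indices. *)

definition autoconv :: "(nat \<Rightarrow> real) \<Rightarrow> nat \<Rightarrow> real" where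
  "autoconv x i = (\<Sum>j\<le>i. x (i - j) * x j)"

(* The usual conventions 0 log 0 = 0 and 0 log (0/0) = 0 hold because 0 * ln _ = 0. *)
definition I_div :: "'i set \<Rightarrow> ('i \<Rightarrow> real) \<Rightarrow> ('i \<Rightarrow> real) \<Rightarrow> ereal" where
  "I_div A u v =
     (if \<forall>a\<in>A. v a = 0 \<longrightarrow> u a = 0
      then ereal (\<Sum>a\<in>A. (u a * ln (u a / v a) - u a + v a))
      else \<infinity>)"

definition objective :: "nat \<Rightarrow> (nat \<Rightarrow> real) \<Rightarrow> (nat \<Rightarrow> real) \<Rightarrow> ereal" where
  "objective n y x = I_div {..n} y (autoconv x)"

(* Partial derivative of the objective with respect to x_k, relative to the domain
   [0,\<infinity>)^(n+1): it is one-sided where x_k = 0, and two-sided where x_k > 0. *)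
definition gradient :: "nat \<Rightarrow> (nat \<Rightarrow> real) \<Rightarrow> (nat \<Rightarrow> real) \<Rightarrow> nat \<Rightarrow> real" where
  "gradient n y x k =
     vector_derivative (\<lambda>s. real_of_ereal (objective n y (x(k := s)))) (at (x k) within {0..})"

(* If (x*x)_i = 0 this is 0, by x / 0 = 0. *)
definition ratio :: "(nat \<Rightarrow> real) \<Rightarrow> (nat \<Rightarrow> real) \<Rightarrow> nat \<Rightarrow> real" where
  "ratio y x i = y i / autoconv x i"

definition rvec :: "nat \<Rightarrow> (nat \<Rightarrow> real) \<Rightarrow> (nat \<Rightarrow> real) \<Rightarrow> nat \<Rightarrow> real" where
  "rvec n y x j = x j * (\<Sum>i\<le>n - j. x i * ratio y x (i + j))"

(* x t j is the j-th component of the t-th iterate.  Only solving the system is required,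
   not uniqueness of the solution.  When y is nonzero, at most one sequence has a given
   x 0.  When y = 0 and n >= 1, the system for x 1 reads x_j * (x_0 + ... + x_(n-j)) = 0
   and leaves x_n free, so the algorithm is not well defined. *)
definition deautoconv_iterates :: "nat \<Rightarrow> (nat \<Rightarrow> real) \<Rightarrow> (nat \<Rightarrow> nat \<Rightarrow> real) \<Rightarrow> bool" where
  "deautoconv_iterates n y x \<longleftrightarrow>
     (\<forall>j\<le>n. 0 < x 0 j) \<and>
     (\<forall>t. \<forall>j\<le>n. 0 \<le> x (Suc t) j \<and>
        x (Suc t) j * (\<Sum>i\<le>n - j. x (Suc t) i) = rvec n y (x t) j)"

definition W_mat :: "(nat \<Rightarrow> real) \<Rightarrow> nat \<times> nat \<Rightarrow> real" where
  "W_mat x = (\<lambda>(i, j). if j \<le> i then x (i - j) * x j else 0)"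

definition Y_mat :: "(nat \<Rightarrow> real) \<Rightarrow> (nat \<Rightarrow> real) \<Rightarrow> nat \<times> nat \<Rightarrow> real" where
  "Y_mat y x = (\<lambda>(i, j). if j \<le> i then x j * x (i - j) * ratio y x i else 0)"

definition balanced_set :: "nat \<Rightarrow> (nat \<Rightarrow> real) \<Rightarrow> (nat \<Rightarrow> real) set" where
  "balanced_set n y =
     {x. (\<forall>i\<le>n. 0 \<le> x i) \<and> (\<Sum>i\<le>n. autoconv x i) = (\<Sum>i\<le>n. y i)}"

end

theory Submission
  imports Defs
begin

text \<open>
  Substituting \<open>k = i + j\<close> turns every sum over a convolution into a sum over the triangle
  \<open>i + j \<le> n\<close>, where entry \<open>(i, j)\<close> of \<open>W\<close> is the symmetric product \<open>x\<^sub>i x\<^sub>j\<close> and that of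
  \<open>Y\<close> is \<open>x\<^sub>i x\<^sub>j \<rho>\<^sub>k\<close>. The diagonals \<open>i + j = k\<close> of \<open>Y\<close> sum to \<open>y\<^sub>k\<close>, and its column
  \<open>j\<close> sums to \<open>r\<^sub>j\<close>. The system for the new iterate \<open>x'\<close> says that the new \<open>W\<close> has the
  same column sums \<open>r\<^sub>j\<close>. In particular its total is \<open>\<Sum> y\<close>, which is balancedness.

  The decrease identity (lemma \<open>objective_decrease\<close>) is a Pythagorean rule. Put
  \<open>g\<^sub>j = ln (x'\<^sub>j / x\<^sub>j)\<close>. The logarithm of the quotient of the two matrices \<open>W\<close> at \<open>(i, j)\<close>
  is \<open>g\<^sub>i + g\<^sub>j\<close>, so by symmetry its sum against either the new \<open>W\<close> or the old \<open>Y\<close> depends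
  only on column sums, and is \<open>2 \<Sum> r\<^sub>j g\<^sub>j\<close> in both cases. This quantity enters the
  divergence of the \<open>W\<close> with a plus sign (lemma \<open>I_div_W\<close>) and that of the \<open>Y\<close> with a minus
  sign (lemma \<open>I_div_Y\<close>); it cancels in the sum, and what remains is the decrease of the
  objective. Since the objective is nonnegative and finite, its decrements tend to \<open>0\<close>, and
  with them the smaller divergence of the \<open>W\<close>.

  Perfect matches and stationary points are points where \<open>x\<close> itself solves the system for
  \<open>x'\<close>. So both fixed-point claims reduce to uniqueness of its solution (lemma
  \<open>fixed_point\<close>): if \<open>W\<close> and \<open>W'\<close> have equal column sums, then
  \<open>\<Sum> (W' - W) (ln W' - ln W) = 0\<close>, and as the logarithm is strictly increasing, all entries
  agree.

  Zeros need care, because iterates may lose positivity when \<open>y\<^sub>n = 0\<close>. If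
  \<open>x\<^sub>i x\<^sub>j y\<^sub>k > 0\<close> with \<open>k = i + j\<close>, then \<open>r\<^sub>i\<close> and \<open>r\<^sub>j\<close> are positive, hence so are
  \<open>x'\<^sub>i\<close> and \<open>x'\<^sub>j\<close> (lemma \<open>x'_pos\<close>). Thus a convolution that is positive on the support of
  \<open>y\<close> stays so, and the objective remains finite. The same argument with
  \<open>j = 0\<close> and an \<open>i\<close> such that \<open>y\<^sub>i > 0\<close> keeps \<open>x\<^sub>0\<close> and \<open>x\<^sub>i\<close> positive, so that all partial
  sums in the system are positive and an entry that is zero stays zero. Only \<open>n = 0\<close> with
  \<open>y = 0\<close> escapes this, where the system is \<open>x'\<^sub>0\<^sup>2 = 0\<close>.
\<close>

section \<open>Sums over the triangle\<close>

lemma sum_triangle: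
  fixes f :: "nat \<Rightarrow> nat \<Rightarrow> real"
  shows "(\<Sum>i\<le>n. \<Sum>j\<le>i. f (i - j) j) = (\<Sum>j\<le>n. \<Sum>i\<le>n - j. f i j)"
  unfolding sum.Sigma[OF finite_atMost ballI[OF finite_atMost]]
  by (rule sum.reindex_bij_witness
        [where i = "\<lambda>(j, i). (i + j, j)" and j = "\<lambda>(i, j). (j, i - j)"]) auto

lemma sum_triangle_swap:
  fixes f :: "nat \<Rightarrow> nat \<Rightarrow> real"
  shows "(\<Sum>j\<le>n. \<Sum>i\<le>n - j. f i j) = (\<Sum>j\<le>n. \<Sum>i\<le>n - j. f j i)"
  unfolding sum.Sigma[OF finite_atMost ballI[OF finite_atMost]]
  by (rule sum.reindex_bij_witness[where i = "\<lambda>(j, i). (i, j)" and j = "\<lambda>(j, i). (i, j)"]) auto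

lemma sum_triangle_cong:
  fixes f g :: "nat \<Rightarrow> nat \<Rightarrow> real"
  assumes "\<And>i j. i + j \<le> n \<Longrightarrow> f i j = g i j"
  shows "(\<Sum>j\<le>n. \<Sum>i\<le>n - j. f i j) = (\<Sum>j\<le>n. \<Sum>i\<le>n - j. g i j)"
  by (intro sum.cong refl assms) auto

lemma sum_lower_triangular_matrix:
  fixes h :: "nat \<times> nat \<Rightarrow> real"
  assumes "\<And>i j. i < j \<Longrightarrow> h (i, j) = 0"
  shows "(\<Sum>a\<in>{..n} \<times> {..n}. h a) = (\<Sum>j\<le>n. \<Sum>i\<le>n - j. h (i + j, j))"
proof -
  have "(\<Sum>a\<in>{..n} \<times> {..n}. h a) = (\<Sum>i\<le>n. \<Sum>j\<le>n. h (i, j))"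
    by (simp add: sum.cartesian_product)
  also have "\<dots> = (\<Sum>i\<le>n. \<Sum>j\<le>i. h (i, j))"
    by (intro sum.cong refl sum.mono_neutral_right) (auto intro!: assms)
  also have "\<dots> = (\<Sum>i\<le>n. \<Sum>j\<le>i. h ((i - j) + j, j))"
    by (intro sum.cong) auto
  also have "\<dots> = (\<Sum>j\<le>n. \<Sum>i\<le>n - j. h (i + j, j))"
    by (rule sum_triangle)
  finally show ?thesis .
qed

text \<open>The two halves of \<open>g i + g j\<close> contribute equally, by symmetry of \<open>a\<close>; so only the
  column sums of \<open>a\<close> matter.\<close>
lemma sum_triangle_symmetric:
  fixes a :: "nat \<Rightarrow> nat \<Rightarrow> real" and g :: "nat \<Rightarrow> real"
  assumes "\<And>i j. a i j = a j i"
  shows "(\<Sum>j\<le>n. \<Sum>i\<le>n - j. a i j * (g i + g j)) = 2 * (\<Sum>j\<le>n. (\<Sum>i\<le>n - j. a i j) * g j)"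
proof -
  have "(\<Sum>j\<le>n. \<Sum>i\<le>n - j. a i j * g i) = (\<Sum>j\<le>n. \<Sum>i\<le>n - j. a i j * g j)"
    by (subst sum_triangle_swap) (simp add: assms)
  then show ?thesis
    by (simp add: distrib_left sum.distrib sum_distrib_right)
qed

lemma sum_autoconv:
  "(\<Sum>i\<le>n. autoconv x i) = (\<Sum>j\<le>n. \<Sum>i\<le>n - j. x i * x j)"
  unfolding autoconv_def by (rule sum_triangle)

lemma autoconv_nonneg:
  assumes "\<And>j. j \<le> i \<Longrightarrow> 0 \<le> x j"
  shows "0 \<le> autoconv x i"
  unfolding autoconv_def by (intro sum_nonneg mult_nonneg_nonneg assms) auto

lemma autoconv_pos_iff:
  assumes "\<And>j. j \<le> i \<Longrightarrow> 0 \<le> x j"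
  shows "0 < autoconv x i \<longleftrightarrow> (\<exists>a b. a + b = i \<and> 0 < x a \<and> 0 < x b)"
proof
  assume "0 < autoconv x i"
  then obtain j where j: "j \<le> i" "0 < x (i - j) * x j"
    unfolding autoconv_def by (metis (no_types, lifting) atMost_iff not_le sum_nonpos)
  moreover have "0 \<le> x (i - j)" "0 \<le> x j" using assms j by auto
  ultimately show "\<exists>a b. a + b = i \<and> 0 < x a \<and> 0 < x b"
    by (intro exI[of _ "i - j"] exI[of _ j]) (auto simp: zero_less_mult_iff)
next
  assume "\<exists>a b. a + b = i \<and> 0 < x a \<and> 0 < x b"
  then obtain a b where "a + b = i" "0 < x a" "0 < x b" by blast
  then show "0 < autoconv x i"
    unfolding autoconv_def
    by (intro sum_pos2[of _ b] mult_nonneg_nonneg assms) auto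
qed

section \<open>The I-divergence\<close>

lemma I_div_eq_sum:
  assumes "\<And>a. a \<in> A \<Longrightarrow> v a = 0 \<Longrightarrow> u a = 0"
  shows "I_div A u v = ereal (\<Sum>a\<in>A. (u a * ln (u a / v a) - u a + v a))"
  using assms by (simp add: I_div_def)

text \<open>Each term is nonnegative, by \<open>ln s \<le> s - 1\<close> at \<open>s = v a / u a\<close>.\<close>
lemma I_div_nonneg:
  assumes "\<And>a. a \<in> A \<Longrightarrow> 0 \<le> u a" "\<And>a. a \<in> A \<Longrightarrow> 0 \<le> v a"
  shows "0 \<le> I_div A u v"
proof -
  have "0 \<le> u a * ln (u a / v a) - u a + v a" if a: "a \<in> A" and "v a = 0 \<longrightarrow> u a = 0" for a
  proof (cases "u a = 0 \<or> v a = 0")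
    case True
    then show ?thesis using assms that by force
  next
    case False
    then have pos: "0 < u a" "0 < v a" using assms a by (auto simp: order_less_le)
    then have "u a * ln (v a / u a) \<le> u a * (v a / u a - 1)"
      by (intro mult_left_mono ln_le_minus_one) auto
    also have "\<dots> = v a - u a"
      using pos by (simp add: right_diff_distrib)
    finally show ?thesis using pos by (simp add: ln_div right_diff_distrib)
  qed
  then show ?thesis by (auto simp: I_div_def intro!: sum_nonneg)
qed

section \<open>Points where the objective is finite\<close>

text \<open>Positivity of the convolution on the support of \<open>y\<close> is what makes the objective finite.
  Zero entries of \<open>x\<close> are allowed, since later iterates can have them.\<close>
locale supported_point =
  fixes n :: nat and y x :: "nat \<Rightarrow> real"
  assumes y_nonneg: "i \<le> n \<Longrightarrow> 0 \<le> y i"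
    and x_nonneg: "i \<le> n \<Longrightarrow> 0 \<le> x i"
    and autoconv_pos: "i \<le> n \<Longrightarrow> 0 < y i \<Longrightarrow> 0 < autoconv x i"
begin

lemma conv_nonneg: "i \<le> n \<Longrightarrow> 0 \<le> autoconv x i"
  by (intro autoconv_nonneg x_nonneg) auto

lemma ratio_nonneg: "i \<le> n \<Longrightarrow> 0 \<le> ratio y x i"
  by (simp add: ratio_def y_nonneg conv_nonneg)

lemma y_eq_0: "i \<le> n \<Longrightarrow> autoconv x i = 0 \<Longrightarrow> y i = 0"
  using autoconv_pos[of i] y_nonneg[of i] by force

lemma ratio_mult_autoconv: "i \<le> n \<Longrightarrow> ratio y x i * autoconv x i = y i"
  using y_eq_0 by (auto simp: ratio_def)

lemma objective_eq_sum:
  "I_div {..n} y (autoconv x)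
     = ereal (\<Sum>i\<le>n. (y i * ln (y i / autoconv x i) - y i + autoconv x i))"
  by (rule I_div_eq_sum) (simp add: y_eq_0)

text \<open>The diagonal \<open>i + j = k\<close> of \<open>Y\<close> sums to \<open>ratio y x k * autoconv x k = y k\<close>, so \<open>y\<close> is
  recovered from \<open>Y\<close> under any weight that is constant along diagonals.\<close>
lemma sum_Y_weighted:
  "(\<Sum>j\<le>n. \<Sum>i\<le>n - j. x i * x j * ratio y x (i + j) * c (i + j)) = (\<Sum>k\<le>n. y k * c k)"
proof -
  have "(\<Sum>j\<le>n. \<Sum>i\<le>n - j. x i * x j * ratio y x (i + j) * c (i + j))
      = (\<Sum>k\<le>n. \<Sum>j\<le>k. x (k - j) * x j * ratio y x ((k - j) + j) * c ((k - j) + j))"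
    by (rule sum_triangle[symmetric])
  also have "\<dots> = (\<Sum>k\<le>n. (ratio y x k * autoconv x k) * c k)"
    by (simp add: autoconv_def sum_distrib_left sum_distrib_right mult_ac)
  also have "\<dots> = (\<Sum>k\<le>n. y k * c k)"
    by (simp add: ratio_mult_autoconv)
  finally show ?thesis .
qed

lemma rvec_eq_sum: "rvec n y x j = (\<Sum>i\<le>n - j. x i * x j * ratio y x (i + j))"
  by (simp add: rvec_def sum_distrib_left mult_ac)

lemma sum_rvec: "(\<Sum>j\<le>n. rvec n y x j) = (\<Sum>i\<le>n. y i)"
  using sum_Y_weighted[of "\<lambda>_. 1"] by (simp add: rvec_eq_sum)

lemma rvec_pos:
  assumes "i + j \<le> n" "0 < x i" "0 < x j" "0 < y (i + j)"
  shows "0 < rvec n y x j"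
proof -
  have "0 < ratio y x (i + j)"
    using assms autoconv_pos by (simp add: ratio_def)
  then show ?thesis
    unfolding rvec_eq_sum using assms
    by (intro sum_pos2[of _ i] mult_nonneg_nonneg ratio_nonneg x_nonneg) auto
qed

lemma autoconv_upd_has_derivative:
  "((\<lambda>s. autoconv (x(k := s)) i) has_real_derivative (if k \<le> i then 2 * x (i - k) else 0))
     (at (x k) within A)"
proof -
  let ?d = "\<lambda>i. if i = k then 1 else 0 :: real"
  have upd: "((\<lambda>s. (x(k := s)) i) has_real_derivative ?d i) (at (x k) within A)" for i
    by (cases "i = k") auto
  have "((\<lambda>s. autoconv (x(k := s)) i) has_real_derivative
          (\<Sum>j\<le>i. ?d (i - j) * x j + ?d j * x (i - j))) (at (x k) within A)"
    unfolding autoconv_def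
    by (intro DERIV_sum) (rule DERIV_cong, rule DERIV_mult[OF upd upd], simp)
  moreover have "(\<Sum>j\<le>i. ?d (i - j) * x j + ?d j * x (i - j)) = (if k \<le> i then 2 * x (i - k) else 0)"
  proof -
    have "(\<Sum>j\<le>i. ?d (i - j) * x j) = (\<Sum>j\<le>i. ?d j * x (i - j))"
      by (rule sum.reindex_bij_witness[where i = "\<lambda>j. i - j" and j = "\<lambda>j. i - j"]) auto
    moreover have "(\<Sum>j\<le>i. ?d j * x (i - j)) = (if k \<le> i then x (i - k) else 0)"
    proof -
      have "(\<Sum>j\<le>i. ?d j * x (i - j)) = (\<Sum>j\<le>i. if j = k then x (i - j) else 0)"
        by (intro sum.cong) auto
      then show ?thesis by simp
    qed
    ultimately show ?thesis by (simp add: sum.distrib)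
  qed
  ultimately show ?thesis by simp
qed

text \<open>Near \<open>x k\<close> the convolution stays positive on the support of \<open>y\<close>, so there the objective
  is the finite sum and can be differentiated term by term. Where \<open>y i = 0\<close>, the term is the
  convolution alone and \<open>ratio y x i = 0\<close>, so the same formula holds even if the convolution
  vanishes; and one-sidedness at \<open>x k = 0\<close> does not affect the calculation.\<close>
lemma gradient_eq:
  assumes k: "k \<le> n"
  shows "gradient n y x k = - 2 * (\<Sum>j\<le>n - k. (ratio y x (j + k) - 1) * x j)"
proof -
  let ?F = "at (x k) within {0..}"
  let ?v = "\<lambda>i s. autoconv (x(k := s)) i"
  let ?v' = "\<lambda>i. if k \<le> i then 2 * x (i - k) else 0"
  let ?obj = "\<lambda>s. real_of_ereal (objective n y (x(k := s)))"
  let ?sum = "\<lambda>s. \<Sum>i\<le>n. (y i * ln (y i / ?v i s) - y i + ?v i s)"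
  have eq: "?obj s = ?sum s" if "\<forall>i\<le>n. 0 < y i \<longrightarrow> 0 < ?v i s" for s
  proof -
    have "y i = 0" if "i \<le> n" "?v i s = 0" for i
      using that \<open>\<forall>i\<le>n. 0 < y i \<longrightarrow> 0 < ?v i s\<close> y_nonneg[of i] by force
    then show ?thesis by (subst objective_def, subst I_div_eq_sum) auto
  qed
  have "((\<lambda>s. y i * ln (y i / ?v i s) - y i + ?v i s) has_real_derivative
          (1 - ratio y x i) * ?v' i) ?F" if i: "i \<le> n" for i
  proof (cases "y i = 0")
    case True
    then show ?thesis
      using autoconv_upd_has_derivative by (simp add: ratio_def)
  next
    case False
    then have pos: "0 < y i" "0 < autoconv x i" using i y_nonneg[of i] autoconv_pos[of i] by auto
    note [derivative_intros] = autoconv_upd_has_derivative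
    show ?thesis
      using pos by (auto intro!: derivative_eq_intros simp: ratio_def field_simps power2_eq_square)
  qed
  then have "(?sum has_real_derivative (\<Sum>i\<le>n. (1 - ratio y x i) * ?v' i)) ?F"
    by (intro DERIV_sum) auto
  moreover have "\<forall>\<^sub>F s in ?F. \<forall>i\<in>{..n}. 0 < y i \<longrightarrow> 0 < ?v i s"
  proof (intro eventually_ball_finite ballI)
    fix i assume i: "i \<in> {..n}"
    show "\<forall>\<^sub>F s in ?F. 0 < y i \<longrightarrow> 0 < ?v i s"
    proof (cases "0 < y i")
      case True
      have "(?v i \<longlongrightarrow> ?v i (x k)) ?F"
        using DERIV_continuous[OF autoconv_upd_has_derivative] by (simp add: continuous_within)
      then have "\<forall>\<^sub>F s in ?F. 0 < ?v i s"
        by (rule order_tendstoD) (use True i autoconv_pos[of i] in auto)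
      then show ?thesis by eventually_elim simp
    qed simp
  qed simp
  then have "\<forall>\<^sub>F s in ?F. ?sum s = ?obj s"
    by eventually_elim (simp add: eq)
  moreover have "?sum (x k) = ?obj (x k)"
    using eq[of "x k"] autoconv_pos by simp
  ultimately have "(?obj has_vector_derivative (\<Sum>i\<le>n. (1 - ratio y x i) * ?v' i)) ?F"
    unfolding has_real_derivative_iff_has_vector_derivative has_vector_derivative_def
    using x_nonneg[OF k] by (auto intro: has_derivative_transform_eventually)
  moreover have "at_right (x k) \<le> ?F"
    by (rule at_le) (use x_nonneg[OF k] in auto)
  then have "?F \<noteq> bot"
    using trivial_limit_at_right_real[of "x k"] by (auto simp: bot_unique)
  ultimately have "gradient n y x k = (\<Sum>i\<le>n. (1 - ratio y x i) * ?v' i)"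
    unfolding gradient_def by (intro vector_derivative_within)
  also have "\<dots> = (\<Sum>i\<in>{k..n}. (1 - ratio y x i) * (2 * x (i - k)))"
    by (intro sum.mono_neutral_cong_right) auto
  also have "\<dots> = (\<Sum>j\<le>n - k. (1 - ratio y x (j + k)) * (2 * x j))"
    by (rule sum.reindex_bij_witness[where i = "\<lambda>j. j + k" and j = "\<lambda>i. i - k"]) (use k in auto)
  also have "\<dots> = - 2 * (\<Sum>j\<le>n - k. (ratio y x (j + k) - 1) * x j)"
    by (simp add: sum_distrib_left algebra_simps)
  finally show ?thesis .
qed

lemma rvec_eq_gradient:
  assumes "j \<le> n"
  shows "rvec n y x j = x j * (- (1 / 2) * gradient n y x j + (\<Sum>i\<le>n - j. x i))"
proof -
  have "(\<Sum>i\<le>n - j. x i * ratio y x (i + j))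
      = (\<Sum>i\<le>n - j. (ratio y x (i + j) - 1) * x i) + (\<Sum>i\<le>n - j. x i)"
    unfolding sum.distrib[symmetric] by (simp add: algebra_simps)
  then show ?thesis using assms by (simp add: gradient_eq rvec_def)
qed

lemma sum_mult_gradient:
  "(\<Sum>j\<le>n. x j * gradient n y x j) = 2 * ((\<Sum>i\<le>n. autoconv x i) - (\<Sum>i\<le>n. y i))"
proof -
  have "(\<Sum>j\<le>n. x j * gradient n y x j)
      = (\<Sum>j\<le>n. 2 * ((\<Sum>i\<le>n - j. x i * x j) - rvec n y x j))"
    by (intro sum.cong refl)
       (simp add: rvec_eq_gradient algebra_simps sum_distrib_left)
  also have "\<dots> = 2 * ((\<Sum>i\<le>n. autoconv x i) - (\<Sum>i\<le>n. y i))"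
    unfolding sum_rvec[symmetric] sum_autoconv
    by (simp only: sum_distrib_left[symmetric] sum_subtractf)
  finally show ?thesis .
qed

text \<open>At a perfect match the ratio is \<open>1\<close> wherever the convolution is positive, in particular at
  every index \<open>i + j\<close> with \<open>x i * x j > 0\<close>; the other products do not contribute.\<close>
lemma rvec_perfect_match:
  assumes "\<And>i. i \<le> n \<Longrightarrow> y i = autoconv x i" "j \<le> n"
  shows "rvec n y x j = x j * (\<Sum>i\<le>n - j. x i)"
proof -
  have "x i * x j * ratio y x (i + j) = x i * x j" if "i + j \<le> n" for i
  proof (cases "x i = 0 \<or> x j = 0")
    case False
    then have "0 < x i" "0 < x j"
      using that x_nonneg[of i] x_nonneg[of j] by auto
    moreover have "0 < autoconv x (i + j) \<longleftrightarrow> (\<exists>a b. a + b = i + j \<and> 0 < x a \<and> 0 < x b)"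
      by (rule autoconv_pos_iff) (use that x_nonneg in auto)
    ultimately have "0 < autoconv x (i + j)"
      by blast
    then show ?thesis using assms that by (simp add: ratio_def)
  qed auto
  then show ?thesis
    using assms unfolding rvec_eq_sum by (auto simp: sum_distrib_left mult.commute intro!: sum.cong)
qed

end

section \<open>One step of the algorithm\<close>

text \<open>Positivity of \<open>x 0\<close> and of \<open>x i\<close> for some \<open>i\<close> in the support of \<open>y\<close> is an
  invariant that every step passes on to \<open>x'\<close>. It makes the sums
  \<open>\<Sum>i\<le>n - j. x' i\<close> positive, and so excludes the situation that the system leaves an entry of
  \<open>x'\<close> undetermined. For \<open>n = 0\<close> the system reads \<open>x' 0 * x' 0 = y 0\<close> wherever \<open>x 0 > 0\<close>, and
  determines \<open>x' 0\<close> even when \<open>y 0 = 0\<close>.\<close>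
locale deautoconv_update = supported_point +
  fixes x' :: "nat \<Rightarrow> real"
  assumes x'_nonneg: "i \<le> n \<Longrightarrow> 0 \<le> x' i"
    and update: "j \<le> n \<Longrightarrow> x' j * (\<Sum>i\<le>n - j. x' i) = rvec n y x j"
    and anchor: "n = 0 \<or> (0 < x 0 \<and> (\<exists>i\<le>n. 0 < y i \<and> 0 < x i))"
begin

lemma x'_pos_if_rvec_pos: "j \<le> n \<Longrightarrow> 0 < rvec n y x j \<Longrightarrow> 0 < x' j"
  using update[of j] x'_nonneg[of j] by (cases "x' j = 0") auto

text \<open>The product \<open>x i * x j * ratio y x (i + j)\<close> is a summand of both \<open>rvec n y x i\<close> and
  \<open>rvec n y x j\<close>.\<close>
lemma x'_pos:
  assumes "i + j \<le> n" "0 < x i" "0 < x j" "0 < y (i + j)"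
  shows "0 < x' i" "0 < x' j"
proof -
  show "0 < x' j"
    by (rule x'_pos_if_rvec_pos[OF _ rvec_pos[of i j]]) (use assms in auto)
  show "0 < x' i"
    by (rule x'_pos_if_rvec_pos[OF _ rvec_pos[of j i]]) (use assms in \<open>auto simp: add.commute\<close>)
qed

lemma anchor': "n = 0 \<or> (0 < x' 0 \<and> (\<exists>i\<le>n. 0 < y i \<and> 0 < x' i))"
  using anchor x'_pos[of 0] by fastforce

text \<open>The equation for \<open>x' j\<close> has right-hand side \<open>0\<close>; its second factor is at least
  \<open>x' 0\<close>, which is positive unless \<open>n = 0\<close>, when the equation reads \<open>x' 0 * x' 0 = 0\<close>.\<close>
lemma x'_eq_0:
  assumes j: "j \<le> n" and "x j = 0"
  shows "x' j = 0"
proof -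
  have "x' j * (\<Sum>i\<le>n - j. x' i) = 0"
    using update[OF j] assms by (simp add: rvec_def)
  moreover have "x' 0 \<le> (\<Sum>i\<le>n - j. x' i)"
    by (intro member_le_sum x'_nonneg) auto
  ultimately show ?thesis
    using anchor' j by auto
qed

sublocale new: supported_point n y x'
proof
  fix i assume i: "i \<le> n" "0 < y i"
  have "\<exists>a b. a + b = i \<and> 0 < x a \<and> 0 < x b"
    using autoconv_pos[OF i] autoconv_pos_iff[of i x] x_nonneg i by auto
  then have "\<exists>a b. a + b = i \<and> 0 < x' a \<and> 0 < x' b"
    using x'_pos i by blast
  then show "0 < autoconv x' i"
    using autoconv_pos_iff[of i x'] x'_nonneg i by auto
qed (simp_all add: y_nonneg x'_nonneg)

lemma sum_autoconv_update: "(\<Sum>i\<le>n. autoconv x' i) = (\<Sum>i\<le>n. y i)"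
proof -
  have "(\<Sum>i\<le>n. autoconv x' i) = (\<Sum>j\<le>n. x' j * (\<Sum>i\<le>n - j. x' i))"
    by (simp add: sum_autoconv sum_distrib_left mult.commute)
  then show ?thesis by (simp add: update sum_rvec)
qed

text \<open>The logarithm splits as \<open>ln (x' i / x i) + ln (x' j / x j)\<close>, so by symmetry only the column
  sums of \<open>W_mat x'\<close> enter, which \<open>x'\<close> is chosen to make equal to \<open>rvec n y x\<close>. The two
  remaining sums are the totals of the matrices; they cancel when \<open>x\<close> is balanced.\<close>
lemma I_div_W:
  "I_div ({..n} \<times> {..n}) (W_mat x') (W_mat x)
     = ereal (2 * (\<Sum>j\<le>n. rvec n y x j * ln (x' j / x j))
              - (\<Sum>i\<le>n. y i) + (\<Sum>i\<le>n. autoconv x i))"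
proof -
  let ?g = "\<lambda>j. ln (x' j / x j)"
  have log: "x' i * x' j * ln (x' i * x' j / (x i * x j)) = x' i * x' j * (?g i + ?g j)"
    if "i + j \<le> n" for i j
  proof (cases "x' i = 0 \<or> x' j = 0")
    case False
    then have "0 < x' i" "0 < x' j" "0 < x i" "0 < x j"
      using that x_nonneg[of i] x_nonneg[of j] x'_nonneg[of i] x'_nonneg[of j]
        x'_eq_0[of i] x'_eq_0[of j] by (auto simp: order_less_le)
    then show ?thesis by (simp add: ln_div ln_mult)
  qed auto
  have "I_div ({..n} \<times> {..n}) (W_mat x') (W_mat x)
      = ereal (\<Sum>a\<in>{..n} \<times> {..n}.
                 W_mat x' a * ln (W_mat x' a / W_mat x a) - W_mat x' a + W_mat x a)"
    by (rule I_div_eq_sum) (auto simp: W_mat_def x'_eq_0 split: if_splits)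
  also have "(\<Sum>a\<in>{..n} \<times> {..n}.
                 W_mat x' a * ln (W_mat x' a / W_mat x a) - W_mat x' a + W_mat x a)
      = (\<Sum>j\<le>n. \<Sum>i\<le>n - j.
           x' i * x' j * ln (x' i * x' j / (x i * x j)) - x' i * x' j + x i * x j)"
    by (subst sum_lower_triangular_matrix) (auto simp: W_mat_def)
  also have "\<dots> = (\<Sum>j\<le>n. \<Sum>i\<le>n - j. x' i * x' j * (?g i + ?g j) - x' i * x' j + x i * x j)"
    by (rule sum_triangle_cong) (simp only: log)
  also have "\<dots> = 2 * (\<Sum>j\<le>n. (\<Sum>i\<le>n - j. x' i * x' j) * ?g j)
                   - (\<Sum>i\<le>n. autoconv x' i) + (\<Sum>i\<le>n. autoconv x i)"
    by (subst sum_triangle_symmetric[symmetric])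
       (simp_all add: sum.distrib sum_subtractf sum_autoconv mult.commute)
  also have "(\<Sum>j\<le>n. (\<Sum>i\<le>n - j. x' i * x' j) * ?g j) = (\<Sum>j\<le>n. rvec n y x j * ?g j)"
    by (intro sum.cong refl) (simp add: update[symmetric] sum_distrib_left mult.commute)
  finally show ?thesis by (simp add: sum_autoconv_update)
qed

text \<open>The logarithm of the quotient of the entries \<open>(i + j, j)\<close> splits into a part depending only
  on the diagonal \<open>i + j\<close>, which sees \<open>Y\<close> through its diagonal sums \<open>y\<close>, and minus the
  symmetric part \<open>ln (x' i / x i) + ln (x' j / x j)\<close>, which sees it through its column sums
  \<open>rvec n y x\<close>. Both matrices have total \<open>\<Sum> y\<close>, so the linear terms cancel.\<close>
lemma I_div_Y:
  "I_div ({..n} \<times> {..n}) (Y_mat y x) (Y_mat y x')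
     = ereal ((\<Sum>i\<le>n. y i * ln (autoconv x' i / autoconv x i))
              - 2 * (\<Sum>j\<le>n. rvec n y x j * ln (x' j / x j)))"
proof -
  let ?g = "\<lambda>j. ln (x' j / x j)"
  let ?l = "\<lambda>i. ln (autoconv x' i / autoconv x i)"
  let ?Y = "\<lambda>i j. x i * x j * ratio y x (i + j)"
  let ?Y' = "\<lambda>i j. x' i * x' j * ratio y x' (i + j)"
  have pos: "0 < x' i" "0 < x' j" "0 < x i" "0 < x j" "0 < y (i + j)"
      "0 < autoconv x (i + j)" "0 < autoconv x' (i + j)"
    if "i + j \<le> n" "?Y i j \<noteq> 0" for i j
  proof -
    show *: "0 < x i" "0 < x j" "0 < y (i + j)"
      using that x_nonneg[of i] x_nonneg[of j] y_nonneg[of "i + j"]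
      by (auto simp: ratio_def order_less_le)
    show "0 < x' i" "0 < x' j"
      using x'_pos * that by auto
    show "0 < autoconv x (i + j)" "0 < autoconv x' (i + j)"
      using * that autoconv_pos new.autoconv_pos by auto
  qed
  have log: "?Y i j * ln (?Y i j / ?Y' i j) = ?Y i j * ?l (i + j) - ?Y i j * (?g i + ?g j)"
    if "i + j \<le> n" for i j
  proof (cases "?Y i j = 0")
    case False
    note p = pos[OF that False]
    have "ln (?Y i j / ?Y' i j) = ?l (i + j) - (?g i + ?g j)"
      using p by (simp add: ratio_def ln_div ln_mult)
    then show ?thesis by (simp only: right_diff_distrib)
  qed auto
  have "I_div ({..n} \<times> {..n}) (Y_mat y x) (Y_mat y x')
      = ereal (\<Sum>a\<in>{..n} \<times> {..n}.
                 Y_mat y x a * ln (Y_mat y x a / Y_mat y x' a) - Y_mat y x a + Y_mat y x' a)"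
  proof (rule I_div_eq_sum, rule ccontr)
    fix a assume "a \<in> {..n} \<times> {..n}" "Y_mat y x' a = 0" "Y_mat y x a \<noteq> 0"
    moreover obtain k j where "a = (k, j)" by fastforce
    ultimately have "k \<le> n" "j \<le> k" "?Y (k - j) j \<noteq> 0" "?Y' (k - j) j = 0"
      by (auto simp: Y_mat_def split: if_splits)
    with pos[of "k - j" j] show False
      by (auto simp: ratio_def)
  qed
  also have "(\<Sum>a\<in>{..n} \<times> {..n}.
                 Y_mat y x a * ln (Y_mat y x a / Y_mat y x' a) - Y_mat y x a + Y_mat y x' a)
      = (\<Sum>j\<le>n. \<Sum>i\<le>n - j. ?Y i j * ln (?Y i j / ?Y' i j) - ?Y i j + ?Y' i j)"
    by (subst sum_lower_triangular_matrix) (auto simp: Y_mat_def mult_ac)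
  also have "\<dots> = (\<Sum>j\<le>n. \<Sum>i\<le>n - j.
                     ?Y i j * ?l (i + j) - ?Y i j * (?g i + ?g j) - ?Y i j + ?Y' i j)"
    by (rule sum_triangle_cong) (simp only: log)
  also have "\<dots> = (\<Sum>i\<le>n. y i * ?l i) - (\<Sum>j\<le>n. \<Sum>i\<le>n - j. ?Y i j * (?g i + ?g j))
                  - (\<Sum>i\<le>n. y i) + (\<Sum>i\<le>n. y i)"
    using sum_Y_weighted[of ?l] sum_Y_weighted[of "\<lambda>_. 1"] new.sum_Y_weighted[of "\<lambda>_. 1"]
    by (simp only: sum.distrib sum_subtractf mult_1_right)
  also have "(\<Sum>j\<le>n. \<Sum>i\<le>n - j. ?Y i j * (?g i + ?g j)) = 2 * (\<Sum>j\<le>n. rvec n y x j * ?g j)"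
    by (subst sum_triangle_symmetric) (simp_all add: rvec_eq_sum add.commute mult.commute)
  finally show ?thesis by simp
qed

lemma objective_decrease:
  "I_div {..n} y (autoconv x) - I_div {..n} y (autoconv x')
     = I_div ({..n} \<times> {..n}) (Y_mat y x) (Y_mat y x')
       + I_div ({..n} \<times> {..n}) (W_mat x') (W_mat x)"
proof -
  have "y i * ln (y i / autoconv x i) - y i * ln (y i / autoconv x' i)
      = y i * ln (autoconv x' i / autoconv x i)" if "i \<le> n" for i
  proof (cases "y i = 0")
    case False
    then have "0 < y i" using that y_nonneg[of i] by simp
    then show ?thesis
      using that autoconv_pos[of i] new.autoconv_pos[of i]
      by (simp add: ln_div right_diff_distrib)
  qed auto
  then have "(\<Sum>i\<le>n. y i * ln (y i / autoconv x i)) - (\<Sum>i\<le>n. y i * ln (y i / autoconv x' i))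
      = (\<Sum>i\<le>n. y i * ln (autoconv x' i / autoconv x i))"
    by (simp add: sum_subtractf[symmetric])
  then show ?thesis
    by (simp add: objective_eq_sum new.objective_eq_sum I_div_Y I_div_W
        sum.distrib sum_subtractf sum_autoconv_update)
qed

lemma I_div_W_nonneg: "0 \<le> I_div ({..n} \<times> {..n}) (W_mat x') (W_mat x)"
  by (rule I_div_nonneg) (auto simp: W_mat_def x_nonneg x'_nonneg)

lemma I_div_Y_nonneg: "0 \<le> I_div ({..n} \<times> {..n}) (Y_mat y x) (Y_mat y x')"
  by (rule I_div_nonneg) (auto simp: Y_mat_def x_nonneg x'_nonneg ratio_nonneg new.ratio_nonneg)

lemma objective_mono: "I_div {..n} y (autoconv x') \<le> I_div {..n} y (autoconv x)"
proof -
  have "0 \<le> I_div {..n} y (autoconv x) - I_div {..n} y (autoconv x')"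
    unfolding objective_decrease by (intro add_nonneg_nonneg I_div_W_nonneg I_div_Y_nonneg)
  then show ?thesis by (simp add: objective_eq_sum new.objective_eq_sum)
qed

text \<open>Both \<open>x\<close> and \<open>x'\<close> solve the system with the same right-hand side. Their matrices have equal
  column sums, so the sum of \<open>(W' - W) * (ln W' - ln W)\<close> vanishes. Every summand is nonnegative by
  monotonicity of the logarithm, hence zero, and \<open>W' = W\<close>. Then \<open>x' 0\<^sup>2 = x 0\<^sup>2\<close>, and
  comparing the products \<open>x' 0 * x' j\<close> and \<open>x 0 * x j\<close> gives the other entries.\<close>
lemma fixed_point:
  assumes fixed: "\<And>j. j \<le> n \<Longrightarrow> rvec n y x j = x j * (\<Sum>i\<le>n - j. x i)"
    and j: "j \<le> n"
  shows "x' j = x j"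
proof -
  let ?g = "\<lambda>j. ln (x' j / x j)"
  let ?d = "\<lambda>i j. x' i * x' j - x i * x j"
  have x'_pos: "0 < x' j" if "j \<le> n" "0 < x j" for j
  proof -
    have "0 < (\<Sum>i\<le>n - j. x i)"
      using that anchor by (intro sum_pos2[of _ 0] x_nonneg) auto
    with that show ?thesis by (simp add: x'_pos_if_rvec_pos fixed)
  qed
  \<comment> \<open>The supports of \<open>x\<close> and \<open>x'\<close> agree, so an entry of the two matrices is zero in both or
    positive in both.\<close>
  have cases: "x i * x j = 0 \<and> x' i * x' j = 0 \<or>
      0 < x i * x j \<and> 0 < x' i * x' j \<and> ?g i + ?g j = ln (x' i * x' j) - ln (x i * x j)"
    if "i + j \<le> n" for i j
  proof (cases "x i = 0 \<or> x j = 0")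
    case True
    then show ?thesis using that x'_eq_0[of i] x'_eq_0[of j] by auto
  next
    case False
    then have "0 < x i" "0 < x j"
      using that x_nonneg[of i] x_nonneg[of j] by auto
    then show ?thesis
      using that x'_pos[of i] x'_pos[of j] by (simp add: ln_div ln_mult)
  qed
  have nonneg: "0 \<le> ?d i j * (?g i + ?g j)" if "i + j \<le> n" for i j
    using cases[OF that]
  proof (elim disjE conjE)
    assume *: "0 < x i * x j" "0 < x' i * x' j"
      and g: "?g i + ?g j = ln (x' i * x' j) - ln (x i * x j)"
    show ?thesis
      unfolding g using *
      by (cases "x i * x j \<le> x' i * x' j") (auto intro!: mult_nonneg_nonneg mult_nonpos_nonpos)
  qed auto
  have zero: "?d i j = 0" if "i + j \<le> n" "?d i j * (?g i + ?g j) = 0" for i j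
    using cases[OF that(1)] that(2) ln_inj_iff by fastforce
  have same_marginals: "(\<Sum>i\<le>n - j. ?d i j) = 0" if "j \<le> n" for j
  proof -
    have "(\<Sum>i\<le>n - j. ?d i j) = x' j * (\<Sum>i\<le>n - j. x' i) - x j * (\<Sum>i\<le>n - j. x i)"
      by (simp add: sum_subtractf sum_distrib_left mult.commute)
    then show ?thesis using update fixed that by simp
  qed
  have "(\<Sum>j\<le>n. \<Sum>i\<le>n - j. ?d i j * (?g i + ?g j)) = 2 * (\<Sum>j\<le>n. (\<Sum>i\<le>n - j. ?d i j) * ?g j)"
    by (rule sum_triangle_symmetric) (simp add: mult.commute)
  also have "\<dots> = 0"
    by (simp add: same_marginals)
  finally have "\<forall>j\<le>n. (\<Sum>i\<le>n - j. ?d i j * (?g i + ?g j)) = 0"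
    by (subst (asm) sum_nonneg_eq_0_iff) (auto intro!: sum_nonneg nonneg)
  then have "?d i j * (?g i + ?g j) = 0" if "i + j \<le> n" for i j
    using that sum_nonneg_0[of "{..n - j}" "\<lambda>i. ?d i j * (?g i + ?g j)" i] nonneg by simp
  then have eq: "x' i * x' j = x i * x j" if "i + j \<le> n" for i j
    using zero[OF that] that by simp
  have x0: "x' 0 = x 0"
    using eq[of 0 0] x_nonneg[of 0] x'_nonneg[of 0]
    by (metis power2_eq_iff_nonneg power2_eq_square zero_le add_0)
  show ?thesis
    using eq[of 0 j] j x0 anchor by auto
qed

end

section \<open>The iterates\<close>

text \<open>By induction, every iterate has the finiteness and anchoring properties that the analysis
  of a single step assumes. At \<open>t = 0\<close> they hold because all entries are positive and, if
  \<open>n > 0\<close>, the data are nonzero.\<close>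
lemma deautoconv_iterates_update:
  assumes data: "\<And>i. i \<le> n \<Longrightarrow> 0 \<le> y i"
    and nondegenerate: "n = 0 \<or> (\<exists>i\<le>n. y i \<noteq> 0)"
    and iterates: "deautoconv_iterates n y x"
  shows "deautoconv_update n y (x t) (x (Suc t))"
proof -
  have step: "deautoconv_update n y (x t) (x (Suc t))"
    if "supported_point n y (x t)"
      "n = 0 \<or> (0 < x t 0 \<and> (\<exists>i\<le>n. 0 < y i \<and> 0 < x t i))" for t
    using that iterates
    by (auto simp: deautoconv_update_def deautoconv_update_axioms_def deautoconv_iterates_def)
  have pos0: "0 < x 0 j" if "j \<le> n" for j
    using that iterates by (simp add: deautoconv_iterates_def)
  show ?thesis
  proof (induction t)
    case 0
    have "supported_point n y (x 0)"
    proof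
      fix i assume "i \<le> n"
      then show "0 < autoconv (x 0) i"
        unfolding autoconv_def by (intro sum_pos mult_pos_pos pos0) auto
    qed (auto simp: data pos0 less_imp_le)
    moreover have "n = 0 \<or> (0 < x 0 0 \<and> (\<exists>i\<le>n. 0 < y i \<and> 0 < x 0 i))"
      using nondegenerate data pos0 by (metis order_less_le zero_le)
    ultimately show ?case by (rule step)
  next
    case (Suc t)
    then interpret deautoconv_update n y "x t" "x (Suc t)" .
    show ?case by (rule step[OF new.supported_point_axioms anchor'])
  qed
qed

text \<open>The sequence \<open>a\<close> is nonincreasing and bounded below, so it converges and its decrements,
  which dominate \<open>d\<close>, tend to \<open>0\<close>.\<close>
lemma decrements_tendsto_0:
  fixes a d :: "nat \<Rightarrow> ereal"
  assumes "\<And>t. 0 \<le> a t" "\<And>t. a t < \<infinity>" "\<And>t. 0 \<le> d t" "\<And>t. d t \<le> a t - a (Suc t)"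
  shows "d \<longlonglongrightarrow> 0"
proof -
  have fin: "\<bar>a t\<bar> \<noteq> \<infinity>" for t
    using assms(1)[of t] assms(2)[of t] by (auto simp: ereal_infty_less)
  define b where "b t = real_of_ereal (a t)" for t
  have a: "a t = ereal (b t)" for t
    using fin by (simp add: b_def ereal_real')
  have "0 \<le> a t - a (Suc t)" for t
    using assms(3,4) order_trans by blast
  then have "decseq b"
    by (intro decseq_SucI) (simp add: a)
  moreover have "0 \<le> b t" for t
    using assms(1)[of t] by (simp add: a)
  ultimately obtain L where L: "b \<longlonglongrightarrow> L"
    using decseq_convergent[of b 0] by blast
  have "(\<lambda>t. b t - b (Suc t)) \<longlonglongrightarrow> L - L"
    by (intro tendsto_diff L LIMSEQ_Suc)
  then have "(\<lambda>t. a t - a (Suc t)) \<longlonglongrightarrow> 0"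
    by (simp add: a zero_ereal_def)
  then show ?thesis
    by (rule tendsto_sandwich[rotated 3, OF _ _ ]) (use assms in auto)
qed

theorem proposition4p1:
  fixes n :: nat and y :: "nat \<Rightarrow> real" and x :: "nat \<Rightarrow> nat \<Rightarrow> real"
  assumes data: "\<And>i. i \<le> n \<Longrightarrow> 0 \<le> y i"
    and nondegenerate: "n = 0 \<or> (\<exists>i\<le>n. y i \<noteq> 0)"
    and iterates: "deautoconv_iterates n y x"
  shows
    \<comment> \<open>(i)\<close>
    "(0 < y n \<longrightarrow> (\<forall>t>0. \<forall>j\<le>n. 0 < x t j)) \<and>
    \<comment> \<open>(ii)\<close>
    (\<forall>t>0. x t \<in> balanced_set n y) \<and>
    (\<forall>t\<ge>1. (\<Sum>j\<le>n. x t j * gradient n y (x t) j) = 0) \<and>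
    \<comment> \<open>(iii)\<close>
    (\<forall>t. I_div {..n} y (autoconv (x t)) < \<infinity>) \<and>
    (\<forall>t. I_div {..n} y (autoconv (x (Suc t))) \<le> I_div {..n} y (autoconv (x t))) \<and>
    (\<forall>t. I_div {..n} y (autoconv (x t)) - I_div {..n} y (autoconv (x (Suc t)))
           = I_div ({..n} \<times> {..n}) (Y_mat y (x t)) (Y_mat y (x (Suc t)))
             + I_div ({..n} \<times> {..n}) (W_mat (x (Suc t))) (W_mat (x t))) \<and>
    (\<forall>t. 0 \<le> I_div ({..n} \<times> {..n}) (Y_mat y (x t)) (Y_mat y (x (Suc t)))
             + I_div ({..n} \<times> {..n}) (W_mat (x (Suc t))) (W_mat (x t))) \<and>
    (\<forall>t. x t \<in> balanced_set n y \<longrightarrow>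
           I_div ({..n} \<times> {..n}) (W_mat (x (Suc t))) (W_mat (x t))
             = ereal (2 * (\<Sum>j\<le>n. rvec n y (x t) j * ln (x (Suc t) j / x t j)))) \<and>
    ((\<lambda>t. I_div ({..n} \<times> {..n}) (W_mat (x (Suc t))) (W_mat (x t))) \<longlonglongrightarrow> 0) \<and>
    \<comment> \<open>(iv)\<close>
    (\<forall>t. (\<forall>i\<le>n. y i = autoconv (x t) i) \<longrightarrow> (\<forall>j\<le>n. x (Suc t) j = x t j)) \<and>
    \<comment> \<open>(v)\<close>
    (\<forall>t. \<forall>j\<le>n. x (Suc t) j * (\<Sum>i\<le>n - j. x (Suc t) i)
           = x t j * (- (1 / 2) * gradient n y (x t) j + (\<Sum>i\<le>n - j. x t i))) \<and>
    \<comment> \<open>(vi)\<close>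
    (\<forall>t. (\<forall>k\<le>n. gradient n y (x t) k = 0) \<longrightarrow> (\<forall>j\<le>n. x (Suc t) j = x t j)) \<and>
    (\<forall>t. \<forall>j\<le>n. x t j = 0 \<longrightarrow> x (Suc t) j = 0)"
proof -
  interpret U: deautoconv_update n y "x t" "x (Suc t)" for t
    by (rule deautoconv_iterates_update) fact+
  \<comment> \<open>When \<open>y n > 0\<close>, entry \<open>j\<close> is kept positive by its partner \<open>n - j\<close>.\<close>
  have positive: "\<forall>j\<le>n. 0 < x t j" if "0 < y n" for t
  proof (induction t)
    case 0
    show ?case using iterates by (simp add: deautoconv_iterates_def)
  next
    case (Suc t)
    then show ?case
      using U.x'_pos(2)[of "n - j" j t for j] that by auto
  qed
  have balanced: "x t \<in> balanced_set n y" if "0 < t" for t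
    using that U.sum_autoconv_update U.x_nonneg
    by (cases t) (auto simp: balanced_set_def)
  have euler: "(\<Sum>j\<le>n. x t j * gradient n y (x t) j) = 0" if "1 \<le> t" for t
    using balanced[of t] that by (simp add: U.sum_mult_gradient balanced_set_def)
  have finite: "I_div {..n} y (autoconv (x t)) < \<infinity>" for t
    by (simp add: U.objective_eq_sum)
  have W_formula: "I_div ({..n} \<times> {..n}) (W_mat (x (Suc t))) (W_mat (x t))
             = ereal (2 * (\<Sum>j\<le>n. rvec n y (x t) j * ln (x (Suc t) j / x t j)))"
    if "x t \<in> balanced_set n y" for t
    using that by (simp add: U.I_div_W balanced_set_def)
  have W_tendsto: "(\<lambda>t. I_div ({..n} \<times> {..n}) (W_mat (x (Suc t))) (W_mat (x t))) \<longlonglongrightarrow> 0"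
  proof (rule decrements_tendsto_0)
    show "0 \<le> I_div {..n} y (autoconv (x t))" for t
      by (intro I_div_nonneg) (auto simp: data U.conv_nonneg)
    show "I_div ({..n} \<times> {..n}) (W_mat (x (Suc t))) (W_mat (x t))
        \<le> I_div {..n} y (autoconv (x t)) - I_div {..n} y (autoconv (x (Suc t)))" for t
      unfolding U.objective_decrease using U.I_div_Y_nonneg[of t] by (simp add: ereal_le_add_self2)
  qed (auto simp: finite[simplified] U.I_div_W_nonneg)
  have stationary: "x (Suc t) j = x t j" if "\<forall>k\<le>n. gradient n y (x t) k = 0" "j \<le> n" for t j
    using that by (intro U.fixed_point) (simp_all add: U.rvec_eq_gradient)
  have match: "x (Suc t) j = x t j" if "\<forall>i\<le>n. y i = autoconv (x t) i" "j \<le> n" for t j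
    using that by (intro U.fixed_point U.rvec_perfect_match) auto
  show ?thesis
    using positive balanced euler finite U.objective_mono U.objective_decrease
      add_nonneg_nonneg[OF U.I_div_Y_nonneg U.I_div_W_nonneg] W_formula W_tendsto match
      U.update U.rvec_eq_gradient stationary U.x'_eq_0
    by (intro conjI allI impI) simp_all
qed

end
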